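(* Let $H$ be a real Hilbert space, let $X\subset H$ be a non-convex sequentially weakly closed set and let $u_0\in \mathrm{conv}(X)\setminus X$. Put $$\delta:=\mathrm{dist}(u_0,X)$$ and, for each $r>0$, $$\rho_r:=\sup_{\|y\|<r}\left((\mathrm{dist}(u_0+y,X))^2-\|y\|^2\right).$$ Then, for every convex set $S\subseteq H$ dense in $H$, for every bounded sequentially weakly lower semicontinuous function $\varphi:X\to \mathbb{R}$ and for every $r>0$ satisfying $$r>\frac{\rho_r-\delta^2+\sup_X\varphi-\inf_X\varphi}{2\delta},$$ there exists $y_0\in S$, with $\|y_0-u_0\|<r$, such that the function $x\mapsto \|x-y_0\|^2+\varphi(x)$ has at least two global minima in $X$.
   Context: $\mathrm{conv}(X)$ is the convex hull of $X$; $\mathrm{dist}(u,X)=\inf_{x\in X}\|u-x\|$. In the definition of $\rho_r$ the supremum is over $y\in H$. "Dense" refers to the norm topology. "At least two global minima" means at least two distinct points of $X$ at which the function attains its infimum over $X$. *)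

theory Defs
  imports "HOL-Analysis.Analysis"
begin

definition weakly_converges :: "(nat \<Rightarrow> 'a::real_normed_vector) \<Rightarrow> 'a \<Rightarrow> bool" where
  "weakly_converges x l \<longleftrightarrow>
     (\<forall>f :: 'a \<Rightarrow> real. bounded_linear f \<longrightarrow> (\<lambda>n. f (x n)) \<longlonglongrightarrow> f l)"

definition seq_weakly_closed :: "'a::real_normed_vector set \<Rightarrow> bool" where
  "seq_weakly_closed X \<longleftrightarrow>
     (\<forall>x l. (\<forall>n. x n \<in> X) \<and> weakly_converges x l \<longrightarrow> l \<in> X)"

text \<open>The limit inferior is taken in the extended reals, so that it exists for every
  real-valued function. Only the values on \<open>X\<close> matter.\<close>

definition seq_weakly_lsc_on :: "'a::real_normed_vector set \<Rightarrow> ('a \<Rightarrow> real) \<Rightarrow> bool" where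
  "seq_weakly_lsc_on X \<phi> \<longleftrightarrow>
     (\<forall>x l. (\<forall>n. x n \<in> X) \<and> l \<in> X \<and> weakly_converges x l \<longrightarrow>
        ereal (\<phi> l) \<le> liminf (\<lambda>n. ereal (\<phi> (x n))))"

text \<open>For nonempty \<open>X\<close> and \<open>r > 0\<close> the supremum below is over a nonempty set that is bounded
  above, since \<open>infdist (u\<^sub>0 + y) X \<le> infdist u\<^sub>0 X + norm y\<close>; hence the real-valued \<open>SUP\<close> is
  the true supremum.\<close>

definition rho :: "'a::real_normed_vector set \<Rightarrow> 'a \<Rightarrow> real \<Rightarrow> real" where
  "rho X u\<^sub>0 r = (SUP y \<in> {y. norm y < r}. (infdist (u\<^sub>0 + y) X)\<^sup>2 - (norm y)\<^sup>2)"

end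

theory Submission
  imports Defs "HOL-Complex_Analysis.Great_Picard"
begin

text \<open>Suppose that for every centre \<open>p\<close> in \<open>P = S \<inter> ball u\<^sub>0 r\<close> the minimiser is unique. Up to a term
  independent of \<open>x\<close>, the function to be minimised is affine in \<open>p\<close>, and uniqueness then yields a
  minimax equality over \<open>P\<close>: first over convex hulls of finite subsets of \<open>P\<close>, then over \<open>P\<close> by
  weak compactness. The maximin is at most \<open>\<rho>\<^sub>r + sup \<phi>\<close>, while by density of \<open>S\<close> the supremum
  over \<open>p\<close> at a point \<open>x\<close> is \<open>\<parallel>x - u\<^sub>0\<parallel>\<^sup>2 + 2 r \<parallel>x - u\<^sub>0\<parallel> + \<phi> x \<ge> \<delta>\<^sup>2 + 2 r \<delta> + inf \<phi>\<close>,
  contradicting the choice of \<open>r\<close>.\<close>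

section \<open>Orthogonal projection and Riesz representation\<close>

text \<open>A minimising sequence for the distance to \<open>T\<close> is Cauchy by the
  parallelogram law; at its limit the error is orthogonal to \<open>T\<close>, since no move along
  an \<open>s\<close> in \<open>T\<close> shortens it.\<close>

lemma closed_subspace_projection:
  fixes T :: "'a::{real_inner, complete_space} set"
  assumes T: "subspace T" and "closed T"
  obtains t where "t \<in> T" "\<And>s. s \<in> T \<Longrightarrow> inner (v - t) s = 0"
proof -
  have ne: "T \<noteq> {}" using subspace_0[OF T] by auto
  define d where "d = infdist v T"
  have d0: "d \<ge> 0" by (simp add: d_def infdist_nonneg)
  have dle: "d \<le> norm (v - s)" if "s \<in> T" for s
    using infdist_le[OF that, of v] by (simp add: d_def dist_norm)
  have "\<exists>s\<in>T. norm (v - s) < d + 1 / Suc n" for n :: nat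
  proof (rule ccontr)
    assume "\<not> ?thesis"
    then have "d + 1 / Suc n \<le> dist v s" if "s \<in> T" for s using that by (force simp: dist_norm)
    then have "d + 1 / Suc n \<le> d" 
      unfolding d_def infdist_notempty[OF ne] using ne by (intro cINF_greatest) auto
    then show False by simp
  qed
  then obtain t where tT: "\<And>n. t n \<in> T" and tn: "\<And>n::nat. norm (v - t n) < d + 1 / Suc n" by metis
  have lim: "(\<lambda>n. d + 1 / real (Suc n)) \<longlonglongrightarrow> d"
    using tendsto_add[OF tendsto_const[of d] LIMSEQ_Suc[OF lim_1_over_n]] by simp
  \<comment> \<open>Parallelogram law for \<open>v - t m\<close> and \<open>v - t n\<close>; the
    midpoint of \<open>t m\<close> and \<open>t n\<close> lies in \<open>T\<close>, hence at
    distance at least \<open>d\<close> from \<open>v\<close>.\<close>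
  have key: "(norm (t m - t n))\<^sup>2 \<le> 2 * (norm (v - t m))\<^sup>2 + 2 * (norm (v - t n))\<^sup>2 - 4 * d\<^sup>2" for m n
  proof -
    have "(1/2) *\<^sub>R (t m + t n) \<in> T" using tT T by (simp add: subspace_add subspace_scale)
    then have "d\<^sup>2 \<le> (norm (v - (1/2) *\<^sub>R (t m + t n)))\<^sup>2" using dle d0 by (simp add: power_mono)
    then show ?thesis
      unfolding power2_norm_eq_inner by (simp add: algebra_simps inner_commute)
  qed
  have "Cauchy t"
  proof (rule CauchyI)
    fix e :: real assume e: "e > 0"
    have "(\<lambda>n. 4 * (d + 1 / real (Suc n))\<^sup>2 - 4 * d\<^sup>2) \<longlonglongrightarrow> 4 * d\<^sup>2 - 4 * d\<^sup>2"
      by (intro tendsto_intros lim)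
    then have "eventually (\<lambda>n. 4 * (d + 1 / real (Suc n))\<^sup>2 - 4 * d\<^sup>2 < e\<^sup>2) sequentially"
      using e by (intro order_tendstoD(2)) auto
    then obtain N where N: "4 * (d + 1 / real (Suc N))\<^sup>2 - 4 * d\<^sup>2 < e\<^sup>2"
      by (auto simp: eventually_sequentially)
    have b: "(norm (v - t n))\<^sup>2 \<le> (d + 1 / real (Suc N))\<^sup>2" if "n \<ge> N" for n
    proof (rule power_mono)
      show "norm (v - t n) \<le> d + 1 / real (Suc N)"
        using tn[of n] that by (smt (verit) frac_le of_nat_0_less_iff of_nat_mono Suc_le_mono zero_less_Suc)
    qed simp
    have "norm (t m - t n) < e" if "m \<ge> N" "n \<ge> N" for m n
      using key[of m n] b[OF that(1)] b[OF that(2)] N e by (intro power2_less_imp_less[of _ e]) auto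
    then show "\<exists>M. \<forall>m\<ge>M. \<forall>n\<ge>M. norm (t m - t n) < e" by blast
  qed
  then obtain p where p: "t \<longlonglongrightarrow> p" using Cauchy_convergent convergent_def by blast
  have pT: "p \<in> T" using closed_sequentially[OF \<open>closed T\<close>] tT p by blast
  have "norm (v - p) \<le> d"
  proof (rule LIMSEQ_le)
    show "(\<lambda>n. norm (v - t n)) \<longlonglongrightarrow> norm (v - p)" by (intro tendsto_intros p)
    show "\<exists>N. \<forall>n\<ge>N. norm (v - t n) \<le> d + 1 / real (Suc n)" using tn less_imp_le by blast
  qed (rule lim)
  then have np: "norm (v - p) \<le> norm (v - s)" if "s \<in> T" for s using dle[OF that] by simp
  have "inner (v - p) s = 0" if "s \<in> T" for s
  proof (cases "s = 0")
    case False
    define a where "a = inner (v - p) s / inner s s"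
    have "p + a *\<^sub>R s \<in> T" using T pT that by (simp add: subspace_add subspace_scale)
    from np[OF this] have "(norm (v - p))\<^sup>2 \<le> (norm ((v - p) - a *\<^sub>R s))\<^sup>2" by (simp add: diff_diff_add)
    also have "\<dots> = (norm (v - p))\<^sup>2 - 2 * a * inner (v - p) s + a * a * inner s s"
      unfolding power2_norm_eq_inner by (simp add: algebra_simps inner_commute)
    also have "\<dots> = (norm (v - p))\<^sup>2 - (inner (v - p) s)\<^sup>2 / inner s s"
      using False by (simp add: a_def field_simps power2_eq_square)
    finally have "(inner (v - p) s)\<^sup>2 / inner s s \<le> 0" by simp
    then show ?thesis using False
      by (metis divide_nonpos_pos divide_pos_pos inner_gt_zero_iff less_le_not_le not_less zero_less_power2)
  qed simp
  with pT that show thesis by blast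
qed

text \<open>Projecting a vector with \<open>f v \<noteq> 0\<close> onto the kernel leaves a residue
  \<open>?z\<close> orthogonal to the kernel; every \<open>x\<close> is a kernel vector plus a
  multiple of \<open>?z\<close>.\<close>

lemma riesz_representation:
  fixes f :: "'a::{real_inner, complete_space} \<Rightarrow> real"
  assumes f: "bounded_linear f"
  obtains w where "\<And>x. f x = inner x w"
proof (cases "\<forall>x. f x = 0")
  case True
  then show thesis using that[of 0] by simp
next
  case False
  then obtain v where v: "f v \<noteq> 0" by blast
  interpret f: bounded_linear f by (rule f)
  let ?K = "{x. f x = 0}"
  have "subspace ?K" by (auto simp: subspace_def f.add f.scale f.zero)
  moreover have "closed ?K"
    by (intro closed_Collect_eq f.continuous_on continuous_intros)
  ultimately obtain t where t: "f t = 0" "\<And>s. f s = 0 \<Longrightarrow> inner (v - t) s = 0"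
    using closed_subspace_projection[of ?K v] by auto
  let ?z = "v - t"
  have fz: "f ?z \<noteq> 0" using v t by (simp add: f.diff)
  then have z: "inner ?z ?z \<noteq> 0" using f.zero by force
  have "f x = inner x ((f ?z / inner ?z ?z) *\<^sub>R ?z)" for x
  proof -
    have "f (x - (f x / f ?z) *\<^sub>R ?z) = 0" using fz by (simp add: f.diff f.scale)
    from t(2)[OF this] have "inner ?z x = f x / f ?z * inner ?z ?z"
      by (simp only: inner_diff_right[of ?z x] inner_scaleR_right)
    then show ?thesis using fz z by (simp add: inner_commute[of x] del: inner_diff_left)
  qed
  then show thesis by (rule that)
qed

section \<open>Weak convergence of sequences\<close>

lemma weakly_converges_inner:
  fixes x :: "nat \<Rightarrow> 'a::real_inner"
  assumes "weakly_converges x l"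
  shows "(\<lambda>n. inner (x n) v) \<longlonglongrightarrow> inner l v"
  using assms[unfolded weakly_converges_def, rule_format, OF bounded_linear_inner_left] .

lemma weakly_converges_iff_inner:
  fixes x :: "nat \<Rightarrow> 'a::{real_inner, complete_space}"
  shows "weakly_converges x l \<longleftrightarrow> (\<forall>v. (\<lambda>n. inner (x n) v) \<longlonglongrightarrow> inner l v)"
  unfolding weakly_converges_def
proof (intro iffI allI impI)
  fix f :: "'a \<Rightarrow> real"
  assume x: "\<forall>v. (\<lambda>n. inner (x n) v) \<longlonglongrightarrow> inner l v" and "bounded_linear f"
  then obtain w where "\<And>y. f y = inner y w" using riesz_representation by blast
  with x show "(\<lambda>n. f (x n)) \<longlonglongrightarrow> f l" by simp
qed (rule weakly_converges_inner, simp add: weakly_converges_def)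

lemma tendsto_imp_weakly_converges: "x \<longlonglongrightarrow> l \<Longrightarrow> weakly_converges x l"
  unfolding weakly_converges_def by (auto intro: bounded_linear.tendsto)

lemma weakly_converges_subseq:
  "weakly_converges x l \<Longrightarrow> strict_mono k \<Longrightarrow> weakly_converges (x \<circ> k) l"
  unfolding weakly_converges_def using LIMSEQ_subseq_LIMSEQ by (fastforce simp: comp_def)

lemma seq_weakly_closedD:
  "seq_weakly_closed X \<Longrightarrow> (\<And>n. x n \<in> X) \<Longrightarrow> weakly_converges x l \<Longrightarrow> l \<in> X"
  unfolding seq_weakly_closed_def by blast

lemma seq_weakly_closed_imp_closed: "seq_weakly_closed X \<Longrightarrow> closed X"
  unfolding closed_sequential_limits seq_weakly_closed_def
  by (metis tendsto_imp_weakly_converges)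

text \<open>Test vectors along which the extracted products converge form a closed subspace
  containing the sequence, and vectors orthogonal to it give products zero. So all products
  converge, and Riesz turns the limit functional into \<open>l\<close>.\<close>

lemma bounded_weakly_convergent_subseq:
  fixes x :: "nat \<Rightarrow> 'a::{real_inner, complete_space}"
  assumes "bounded (range x)"
  obtains k l where "strict_mono (k::nat \<Rightarrow> nat)" "weakly_converges (x \<circ> k) l"
proof -
  obtain B where B: "\<And>n. norm (x n) \<le> B" and B0: "B > 0"
    using assms unfolding bounded_pos by auto
  have b: "\<bar>inner (x n) v\<bar> \<le> B * norm v" for n v
    using Cauchy_Schwarz_ineq2[of "x n" v] mult_right_mono[OF B[of n] norm_ge_zero[of v]] by linarith
  have "norm (inner (x n) v) \<le> B * B" if "v \<in> range x" for n v
    using b[of n v] that B B0 by (smt (verit) imageE mult_left_mono real_norm_def)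
  \<comment> \<open>Seen as functions on the countable set \<open>range x\<close>, the products are
    bounded by \<open>B * B\<close>, so a diagonal subsequence converges at every point.\<close>
  then obtain k where k: "strict_mono (k::nat\<Rightarrow>nat)"
      "\<And>v. v \<in> range x \<Longrightarrow> \<exists>l. (\<lambda>n. inner (x (k n)) v) \<longlonglongrightarrow> l"
    using function_convergent_subsequence[of "range x" "\<lambda>n v. inner (x n) v" "B * B"]
    by (metis countable_image uncountable_def countableI_type)
  let ?T = "{v. convergent (\<lambda>n. inner (x (k n)) v)}"
  have sub: "subspace ?T"
    unfolding subspace_def
    by (simp add: inner_add_right convergent_const convergent_add convergent_mult)
  have "closed ?T"
    unfolding closed_sequential_limits
  proof (intro allI impI, elim conjE)
    fix v w assume v: "\<forall>n. v n \<in> ?T" and w: "v \<longlonglongrightarrow> w"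
    \<comment> \<open>Replacing \<open>w\<close> by a close \<open>v j\<close> changes every product
      by less than \<open>e / 3\<close>, uniformly in \<open>n\<close>.\<close>
    have "Cauchy (\<lambda>n. inner (x (k n)) w)"
    proof (rule CauchyI)
      fix e :: real assume e: "e > 0"
      then have "e / (3 * B) > 0" using B0 by simp
      then obtain j where j: "norm (v j - w) < e / (3 * B)"
        using w unfolding LIMSEQ_def dist_norm by blast
      have d: "\<bar>inner (x (k n)) w - inner (x (k n)) (v j)\<bar> < e / 3" for n
        using b[of "k n" "w - v j"] mult_strict_left_mono[OF j B0] B0
        by (simp add: inner_diff_right norm_minus_commute)
      have "Cauchy (\<lambda>n. inner (x (k n)) (v j))" using v by (auto intro: convergent_Cauchy)
      from CauchyD[OF this, of "e / 3"] e obtain N where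
        N: "\<And>m n. m \<ge> N \<Longrightarrow> n \<ge> N \<Longrightarrow> norm (inner (x (k m)) (v j) - inner (x (k n)) (v j)) < e / 3"
        by auto
      have "norm (inner (x (k m)) w - inner (x (k n)) w) < e" if "m \<ge> N" "n \<ge> N" for m n
        using N[OF that] d[of m] d[of n] unfolding real_norm_def by linarith
      then show "\<exists>M. \<forall>m\<ge>M. \<forall>n\<ge>M. norm (inner (x (k m)) w - inner (x (k n)) w) < e" by blast
    qed
    then show "w \<in> ?T" by (simp add: Cauchy_convergent)
  qed
  have conv: "convergent (\<lambda>n. inner (x (k n)) v)" for v
  proof -
    obtain t where t: "t \<in> ?T" "\<And>s. s \<in> ?T \<Longrightarrow> inner (v - t) s = 0"
      using closed_subspace_projection[OF sub \<open>closed ?T\<close>] by blast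
    have "inner (x (k n)) (v - t) = 0" for n
      using t(2)[of "x (k n)"] k(2) by (auto simp: convergent_def inner_commute)
    then have "inner (x (k n)) v = inner (x (k n)) t" for n by (simp add: inner_diff_right)
    then show ?thesis using t(1) by simp
  qed
  define g where "g v = lim (\<lambda>n. inner (x (k n)) v)" for v
  have g: "(\<lambda>n. inner (x (k n)) v) \<longlonglongrightarrow> g v" for v
    using conv unfolding g_def by (simp add: convergent_LIMSEQ_iff)
  have "bounded_linear g"
  proof (rule bounded_linear_intro[where K = B])
    show "g (v + w) = g v + g w" for v w
      using LIMSEQ_unique[OF g[of "v + w"]] tendsto_add[OF g[of v] g[of w]]
      by (simp add: inner_add_right)
    show "g (c *\<^sub>R v) = c *\<^sub>R g v" for c v
      using LIMSEQ_unique[OF g[of "c *\<^sub>R v"]] tendsto_mult_left[OF g[of v], of c] by simp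
    show "norm (g v) \<le> norm v * B" for v
      using b by (intro LIMSEQ_le_const2[OF tendsto_norm[OF g[of v]]]) (auto simp: mult.commute)
  qed
  then obtain l where "\<And>v. g v = inner v l" using riesz_representation by blast
  then have "weakly_converges (x \<circ> k) l"
    using g by (simp add: weakly_converges_iff_inner inner_commute[of l])
  with k(1) that show thesis by blast
qed

text \<open>Test against \<open>l\<close> itself and use Cauchy-Schwarz. The bound varies with
  \<open>n\<close> to accommodate near-minimal points in the finite intersection argument.\<close>

lemma weakly_converges_norm_le:
  fixes x :: "nat \<Rightarrow> 'a::real_inner"
  assumes x: "weakly_converges x l" and le: "\<And>n. norm (x n) \<le> b n" and b: "b \<longlonglongrightarrow> M"
  shows "norm l \<le> M"
proof -
  have "norm l * norm l \<le> M * norm l"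
  proof (rule LIMSEQ_le)
    show "(\<lambda>n. inner (x n) l) \<longlonglongrightarrow> norm l * norm l"
      using weakly_converges_inner[OF x, of l] by (simp add: power2_norm_eq_inner flip: power2_eq_square)
    show "(\<lambda>n. b n * norm l) \<longlonglongrightarrow> M * norm l" by (intro tendsto_intros b)
    show "\<exists>N. \<forall>n\<ge>N. inner (x n) l \<le> b n * norm l"
      using le by (meson mult_right_mono norm_cauchy_schwarz norm_ge_zero order_trans)
  qed
  moreover have "0 \<le> M" using le by (intro LIMSEQ_le_const[OF b]) (metis norm_ge_zero order_trans)
  ultimately show ?thesis by (cases "l = 0") auto
qed

section \<open>Finite intersection property of bounded sequentially weakly closed sets\<close>

lemma seq_weakly_closed_Int:
  "seq_weakly_closed A \<Longrightarrow> seq_weakly_closed B \<Longrightarrow> seq_weakly_closed (A \<inter> B)"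
  unfolding seq_weakly_closed_def Int_iff by metis

lemma seq_weakly_closed_INT:
  "(\<And>i. i \<in> I \<Longrightarrow> seq_weakly_closed (C i)) \<Longrightarrow> seq_weakly_closed (\<Inter>i\<in>I. C i)"
  unfolding seq_weakly_closed_def INT_iff by metis

lemma infdist_near_point:
  fixes e :: real
  assumes "A \<noteq> {}" "e > 0"
  obtains a where "a \<in> A" "dist x a < infdist x A + e"
proof -
  have "(INF a\<in>A. dist x a) < infdist x A + e" using assms by (simp add: infdist_notempty)
  then show thesis using that assms by (auto simp: cINF_less_iff)
qed

text \<open>The Radon-Riesz property: in the expanded square of \<open>norm (x n - l)\<close> the
  bounds for the norms and the cross term cancel in the limit.\<close>

lemma weakly_converges_imp_tendsto:
  fixes x :: "nat \<Rightarrow> 'a::real_inner"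
  assumes x: "weakly_converges x l" and b: "\<And>n. norm (x n) \<le> b n" "b \<longlonglongrightarrow> norm l"
  shows "x \<longlonglongrightarrow> l"
proof -
  have "(\<lambda>n. (b n)\<^sup>2 - 2 * inner (x n) l + (norm l)\<^sup>2) \<longlonglongrightarrow> (norm l)\<^sup>2 - 2 * inner l l + (norm l)\<^sup>2"
    by (intro tendsto_intros b weakly_converges_inner[OF x])
  then have lim: "(\<lambda>n. (b n)\<^sup>2 - 2 * inner (x n) l + (norm l)\<^sup>2) \<longlonglongrightarrow> 0"
    by (simp add: power2_norm_eq_inner)
  have "(norm (x n - l))\<^sup>2 \<le> (b n)\<^sup>2 - 2 * inner (x n) l + (norm l)\<^sup>2" for n
    using power_mono[OF b(1)[of n] norm_ge_zero, of 2]
    unfolding power2_norm_eq_inner by (simp add: algebra_simps inner_commute)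
  then have "(\<lambda>n. (norm (x n - l))\<^sup>2) \<longlonglongrightarrow> 0"
    by (intro tendsto_sandwich[OF _ _ tendsto_const lim]) auto
  from tendsto_real_sqrt[OF this] show ?thesis
    by (simp add: LIM_zero_iff tendsto_norm_zero_iff)
qed

text \<open>The \<open>infdist 0\<close> of the finite subintersections is maximised along a countable subfamily.
  The points of norm at most this maximum in the intersection of that subfamily form a set \<open>K\<close>
  on which weak and strong sequential convergence agree, so \<open>K\<close> is norm compact.\<close>

lemma seq_weakly_closed_fip:
  fixes B :: "'a::{real_inner, complete_space} set"
  assumes B: "bounded B" "seq_weakly_closed B"
    and C: "\<And>i. i \<in> I \<Longrightarrow> seq_weakly_closed (C i)"
    and fip: "\<And>F. finite F \<Longrightarrow> F \<subseteq> I \<Longrightarrow> B \<inter> (\<Inter>i\<in>F. C i) \<noteq> {}"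
  shows "B \<inter> (\<Inter>i\<in>I. C i) \<noteq> {}"
proof -
  define D where "D F = B \<inter> (\<Inter>i\<in>F. C i)" for F
  define m where "m F = infdist 0 (D F)" for F
  define \<F> where "\<F> = {F. finite F \<and> F \<subseteq> I}"
  have ne: "D F \<noteq> {}" if "F \<in> \<F>" for F using fip that by (simp add: D_def \<F>_def)
  have Dcl: "seq_weakly_closed (D F)" if "F \<subseteq> I" for F
    unfolding D_def using C B that by (intro seq_weakly_closed_Int seq_weakly_closed_INT) auto
  have DB: "D F \<subseteq> B" for F by (auto simp: D_def)
  have Dmono: "D G \<subseteq> D F" if "F \<subseteq> G" for F G using that by (auto simp: D_def)
  obtain R where R: "\<And>x. x \<in> B \<Longrightarrow> norm x \<le> R" using B(1) by (auto simp: bounded_iff)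
  have mR: "m F \<le> R" if F: "F \<in> \<F>" for F
  proof -
    obtain x where "x \<in> D F" using ne[OF F] by blast
    then show ?thesis using infdist_le[of x "D F" 0] R[of x] DB by (force simp: m_def)
  qed
  define M where "M = (SUP F\<in>\<F>. m F)"
  have bdd: "bdd_above (m ` \<F>)" using mR by (auto simp: bdd_above_def)
  have mM: "m F \<le> M" if "F \<in> \<F>" for F unfolding M_def by (rule cSUP_upper[OF that bdd])
  have "\<F> \<noteq> {}" by (auto simp: \<F>_def)
  then have "\<exists>F\<in>\<F>. M - 1 / Suc n < m F" for n :: nat
    using less_cSUP_iff[OF _ bdd, of "M - 1 / Suc n"] by (simp add: M_def)
  then obtain A where A: "\<And>n. A n \<in> \<F>" "\<And>n::nat. M - 1 / Suc n < m (A n)" by metis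
  \<comment> \<open>Cumulative unions, so that \<open>D (A' k)\<close> lies in
    \<open>D (A n)\<close> whenever \<open>n \<le> k\<close>.\<close>
  define A' where "A' n = (\<Union>k\<le>n. A k)" for n
  define U where "U = (\<Union>n. A n)"
  have UI: "U \<subseteq> I" using A by (auto simp: U_def \<F>_def)
  have A': "A' n \<in> \<F>" for n using A(1) by (auto simp: A'_def \<F>_def)
  have lim: "(\<lambda>n. M + 1 / real (Suc n)) \<longlonglongrightarrow> M"
    using tendsto_add[OF tendsto_const[of M] LIMSEQ_Suc[OF lim_1_over_n]] by simp
  have lim': "(\<lambda>n. M - 1 / real (Suc n)) \<longlonglongrightarrow> M"
    using tendsto_diff[OF tendsto_const[of M] LIMSEQ_Suc[OF lim_1_over_n]] by simp
  \<comment> \<open>\<open>D U\<close> lies in every \<open>D (A n)\<close>, whose distance from the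
    origin exceeds \<open>M - 1 / Suc n\<close>. Hence points of \<open>K\<close> have norm exactly
    \<open>M\<close>.\<close>
  have MU: "M \<le> norm x" if "x \<in> D U" for x
  proof (rule LIMSEQ_le_const2[OF lim'])
    have "M - 1 / real (Suc n) \<le> norm x" for n
    proof -
      have "x \<in> D (A n)" using that Dmono[of "A n" U] by (auto simp: U_def)
      then show ?thesis using infdist_le[of x "D (A n)" 0] A(2)[of n] by (simp add: m_def)
    qed
    then show "\<exists>N. \<forall>n\<ge>N. M - 1 / real (Suc n) \<le> norm x" by blast
  qed
  define K where "K = D U \<inter> cball 0 M"
  have sub: "\<exists>k l. strict_mono (k::nat\<Rightarrow>nat) \<and> weakly_converges (x \<circ> k) l" if "\<And>n. x n \<in> B"
    for x :: "nat \<Rightarrow> 'a"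
  proof -
    have "bounded (range x)" by (rule bounded_subset[OF B(1)]) (use that in auto)
    then show ?thesis by (rule bounded_weakly_convergent_subseq) auto
  qed
  have "compact K"
    unfolding compact_eq_seq_compact_metric seq_compact_def
  proof (intro allI impI)
    fix x :: "nat \<Rightarrow> 'a" assume x: "\<forall>n. x n \<in> K"
    then obtain k l where k: "strict_mono (k::nat\<Rightarrow>nat)" and l: "weakly_converges (x \<circ> k) l"
      using sub[of x] DB[of U] by (auto simp: K_def)
    have xM: "norm ((x \<circ> k) n) \<le> M" for n using x by (simp add: K_def)
    have lD: "l \<in> D U" by (rule seq_weakly_closedD[OF Dcl[OF UI] _ l]) (use x in \<open>auto simp: K_def\<close>)
    have lM: "norm l \<le> M" by (rule weakly_converges_norm_le[OF l xM tendsto_const])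
    with MU[OF lD] have "norm l = M" by simp
    then have "(x \<circ> k) \<longlonglongrightarrow> l"
      by (intro weakly_converges_imp_tendsto[OF l xM]) simp
    then show "\<exists>l\<in>K. \<exists>r. strict_mono r \<and> (x \<circ> r) \<longlonglongrightarrow> l"
      using k lD lM by (intro bexI[of _ l]) (auto simp: K_def)
  qed
  moreover have "closed (C i)" if "i \<in> I" for i
    using seq_weakly_closed_imp_closed[OF C[OF that]] .
  \<comment> \<open>As \<open>M\<close> bounds \<open>m\<close> on all finite index sets, those
    containing \<open>G\<close> included, \<open>D (A' n \<union> G)\<close> has points of norm
    below \<open>M + 1 / Suc n\<close>. A weak limit of such points is the one sought.\<close>
  moreover have "K \<inter> (\<Inter>i\<in>G. C i) \<noteq> {}" if G: "finite G" "G \<subseteq> I" for G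
  proof -
    have AG: "A' n \<union> G \<in> \<F>" for n using A'[of n] G by (auto simp: \<F>_def)
    have "\<exists>a\<in>D (A' n \<union> G). norm a < M + 1 / Suc n" for n :: nat
    proof -
      obtain a where "a \<in> D (A' n \<union> G)" "dist 0 a < m (A' n \<union> G) + 1 / Suc n"
        using infdist_near_point[OF ne[OF AG], of "1 / Suc n" n 0] by (auto simp: m_def)
      then show ?thesis using mM[OF AG, of n] by force
    qed
    then obtain x :: "nat \<Rightarrow> 'a" where x: "\<And>n. x n \<in> D (A' n \<union> G)" "\<And>n::nat. norm (x n) < M + 1 / Suc n"
      by metis
    obtain k l where k: "strict_mono (k::nat\<Rightarrow>nat)" and l: "weakly_converges (x \<circ> k) l"
      using sub[of x] x(1) DB by (meson subsetD)
    have klim: "(\<lambda>n. M + 1 / real (Suc (k n))) \<longlonglongrightarrow> M"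
      using LIMSEQ_subseq_LIMSEQ[OF lim k] by (simp add: comp_def)
    have "norm ((x \<circ> k) n) \<le> M + 1 / real (Suc (k n))" for n
      using x(2)[of "k n"] by simp
    then have lM: "norm l \<le> M" by (rule weakly_converges_norm_le[OF l _ klim])
    have "l \<in> D (A n \<union> G)" for n
    proof -
      \<comment> \<open>The shift gives indices \<open>k (n + j) \<ge> n\<close>, so this tail stays
        in the weakly closed set \<open>D (A n \<union> G)\<close>.\<close>
      have "(\<lambda>j. x (k (n + j))) = (x \<circ> k) \<circ> (\<lambda>j. n + j)" by (simp add: comp_def)
      then have "weakly_converges (\<lambda>j. x (k (n + j))) l"
        using weakly_converges_subseq[OF l, of "\<lambda>j. n + j"] by (simp add: strict_mono_def)
      moreover have "x (k (n + j)) \<in> D (A n \<union> G)" for j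
      proof -
        have "n \<le> k (n + j)" using seq_suble[OF k, of "n + j"] by simp
        then have "A n \<union> G \<subseteq> A' (k (n + j)) \<union> G" by (auto simp: A'_def)
        then show ?thesis using Dmono x(1) by (meson subsetD)
      qed
      moreover have "A n \<union> G \<subseteq> I" using A(1) G by (auto simp: \<F>_def)
      ultimately show ?thesis
        using seq_weakly_closedD[OF Dcl, of "A n \<union> G" "\<lambda>j. x (k (n + j))" l] by simp
    qed
    then have "l \<in> D (U \<union> G)" by (auto simp: D_def U_def)
    then have "l \<in> K \<inter> (\<Inter>i\<in>G. C i)" using lM by (auto simp: K_def D_def)
    then show ?thesis by blast
  qed
  ultimately have "K \<inter> (\<Inter>i\<in>I. C i) \<noteq> {}" by (rule compact_imp_fip_image)
  then show ?thesis by (auto simp: K_def D_def)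
qed

section \<open>Coercivity and weak lower semicontinuity of the payoff\<close>

text \<open>This is \<open>\<parallel>x - p\<parallel>\<^sup>2 + \<phi> x - \<parallel>p - u\<parallel>\<^sup>2\<close>: for fixed \<open>p\<close> it has the same minimisers
  in \<open>x\<close> as the function of the theorem, and it is affine in \<open>p\<close>.\<close>

definition payoff :: "'a::real_inner \<Rightarrow> ('a \<Rightarrow> real) \<Rightarrow> 'a \<Rightarrow> 'a \<Rightarrow> real" where
  "payoff u \<phi> x p = (norm (x - u))\<^sup>2 - 2 * inner (x - u) (p - u) + \<phi> x"

lemma payoff_eq: "payoff u \<phi> x p = (norm (x - p))\<^sup>2 - (norm (p - u))\<^sup>2 + \<phi> x"
  unfolding payoff_def power2_norm_eq_inner by (simp add: algebra_simps inner_commute)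

lemma payoff_affine:
  "payoff u \<phi> x (q + t *\<^sub>R (p - q)) = (1 - t) * payoff u \<phi> x q + t * payoff u \<phi> x p"
  unfolding payoff_def by (simp add: algebra_simps)

lemma payoff_diff: "payoff u \<phi> x p - payoff u \<phi> x q = 2 * inner (x - u) (q - p)"
  unfolding payoff_def by (simp add: algebra_simps)

lemma payoff_le_add:
  assumes "norm (x - u) \<le> R"
  shows "payoff u \<phi> x p \<le> payoff u \<phi> x q + 2 * R * norm (q - p)"
  using payoff_diff[of u \<phi> x p q] norm_cauchy_schwarz[of "x - u" "q - p"]
    mult_right_mono[OF assms norm_ge_zero[of "q - p"]] by linarith

text \<open>Complete the square in \<open>norm (x - u)\<close>. The bound is uniform over
  \<open>p\<close> within \<open>r\<close> of \<open>u\<close>, which later confines all minimisers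
  to one ball.\<close>

lemma norm_le_of_payoff_le:
  assumes "payoff u \<phi> x p \<le> c" "norm (p - u) \<le> r" "m \<le> \<phi> x"
  shows "norm (x - u) \<le> r + sqrt (c - m + r\<^sup>2)"
proof -
  have "inner (x - u) (p - u) \<le> norm (x - u) * r"
    using norm_cauchy_schwarz[of "x - u" "p - u"] mult_left_mono[OF assms(2) norm_ge_zero[of "x - u"]]
    by linarith
  then have "(norm (x - u) - r)\<^sup>2 \<le> c - m + r\<^sup>2"
    using assms(1,3) by (simp add: payoff_def power2_diff)
  from real_le_rsqrt[OF this] show ?thesis by simp
qed

text \<open>The squared norm lies above its tangent at \<open>l\<close>, which is affine and so
  passes to weak limits. The levels \<open>a n\<close> vary to serve the segment argument for saddle
  points.\<close>

lemma payoff_weak_limit: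
  assumes X: "seq_weakly_closed X" and \<phi>: "seq_weakly_lsc_on X \<phi>"
    and x: "\<And>n. x n \<in> X" "weakly_converges x l"
    and le: "\<And>n. payoff u \<phi> (x n) p \<le> a n" and a: "a \<longlonglongrightarrow> c"
  shows "l \<in> X" "payoff u \<phi> l p \<le> c"
proof -
  show l: "l \<in> X" using seq_weakly_closedD[OF X x] .
  \<comment> \<open>The payoff inequality solved for \<open>\<phi> (x n)\<close>, with the tangent
    in place of the squared norm; at \<open>l\<close> the tangent is exact, whence the limit
    \<open>b'\<close>.\<close>
  define b where "b n = a n + 2 * (inner (x n) (p - u) - inner u (p - u))
    - (2 * (inner (x n) (l - u) - inner u (l - u)) - (norm (l - u))\<^sup>2)" for n
  define b' where "b' = c + 2 * inner (l - u) (p - u) - (norm (l - u))\<^sup>2"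
  have "b \<longlonglongrightarrow> c + 2 * (inner l (p - u) - inner u (p - u))
    - (2 * (inner l (l - u) - inner u (l - u)) - (norm (l - u))\<^sup>2)"
    unfolding b_def by (intro tendsto_intros a weakly_converges_inner[OF x(2)])
  then have b: "b \<longlonglongrightarrow> b'"
    unfolding b'_def by (simp add: power2_norm_eq_inner flip: inner_diff_left)
  have "\<phi> (x n) \<le> b n" for n
  proof -
    have "2 * inner (x n - u) (l - u) - (norm (l - u))\<^sup>2 \<le> (norm (x n - u))\<^sup>2"
      using zero_le_power2[of "norm ((x n - u) - (l - u))"]
      unfolding power2_norm_eq_inner by (simp add: inner_diff_left inner_diff_right inner_commute)
    then show ?thesis using le[of n] unfolding b_def payoff_def by (simp add: inner_diff_left)
  qed
  then have "liminf (\<lambda>n. ereal (\<phi> (x n))) \<le> liminf (\<lambda>n. ereal (b n))"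
    by (intro Liminf_mono) auto
  also have "\<dots> = ereal b'" using b by (intro lim_imp_Liminf) auto
  also have "ereal (\<phi> l) \<le> liminf (\<lambda>n. ereal (\<phi> (x n)))"
    using \<phi> x l by (auto simp: seq_weakly_lsc_on_def)
  finally (xtrans) have "\<phi> l \<le> b'" by simp
  then show "payoff u \<phi> l p \<le> c" by (simp add: payoff_def b'_def)
qed

lemma seq_weakly_closed_payoff_sublevel:
  assumes "seq_weakly_closed X" "seq_weakly_lsc_on X \<phi>"
  shows "seq_weakly_closed {x \<in> X. payoff u \<phi> x p \<le> c}"
  unfolding seq_weakly_closed_def
proof (intro allI impI, elim conjE)
  fix x l assume "\<forall>n. x n \<in> {x \<in> X. payoff u \<phi> x p \<le> c}" "weakly_converges x l"
  then show "l \<in> {x \<in> X. payoff u \<phi> x p \<le> c}"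
    using payoff_weak_limit[OF assms, of x l u p "\<lambda>_. c" c] by simp
qed

lemma bounded_payoff_sublevel:
  assumes "\<And>x. x \<in> X \<Longrightarrow> m \<le> \<phi> x"
  shows "bounded {x \<in> X. payoff u \<phi> x p \<le> c}"
proof (rule bounded_subset[OF bounded_cball])
  show "{x \<in> X. payoff u \<phi> x p \<le> c} \<subseteq> cball u (norm (p - u) + sqrt (c - m + (norm (p - u))\<^sup>2))"
    using norm_le_of_payoff_le[of u \<phi> _ p c "norm (p - u)" m] assms
    by (auto simp: dist_norm norm_minus_commute)
qed

section \<open>Existence of minimisers and the minimax argument\<close>

text \<open>A minimiser is a common point of the sublevel sets \<open>?C z\<close>. Finitely many of
  them share the best of their \<open>z\<close>, and \<open>?C z0\<close> serves as the bounded
  ambient set.\<close>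

lemma payoff_minimizer_exists:
  fixes X :: "'a::{real_inner, complete_space} set"
  assumes X: "seq_weakly_closed X" "seq_weakly_lsc_on X \<phi>" "\<And>x. x \<in> X \<Longrightarrow> m \<le> \<phi> x"
    and "X \<noteq> {}"
  shows "\<exists>x\<in>X. \<forall>z\<in>X. payoff u \<phi> x p \<le> payoff u \<phi> z p"
proof -
  obtain z0 where z0: "z0 \<in> X" using \<open>X \<noteq> {}\<close> by blast
  let ?C = "\<lambda>z. {x \<in> X. payoff u \<phi> x p \<le> payoff u \<phi> z p}"
  have "?C z0 \<inter> (\<Inter>z\<in>X. ?C z) \<noteq> {}"
  proof (rule seq_weakly_closed_fip)
    fix F assume F: "finite F" "F \<subseteq> X"
    then obtain x where "x \<in> insert z0 F" "\<And>z. z \<in> insert z0 F \<Longrightarrow> payoff u \<phi> x p \<le> payoff u \<phi> z p"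
      using ex_is_arg_min_if_finite[of "insert z0 F" "\<lambda>z. payoff u \<phi> z p"]
      by (auto simp: is_arg_min_linorder)
    then show "?C z0 \<inter> (\<Inter>z\<in>F. ?C z) \<noteq> {}" using F z0 by blast
  qed (use X in \<open>auto intro: bounded_payoff_sublevel seq_weakly_closed_payoff_sublevel\<close>)
  then show ?thesis by blast
qed

text \<open>If \<open>J p\<close> denotes the minimum of the payoff at \<open>p\<close>, the point \<open>q\<close> maximises \<open>J\<close> on the
  compact convex hull of \<open>F\<close>. The minimisers at points of a segment tending to \<open>q\<close> converge
  weakly to the minimiser at \<open>q\<close>, which gives the saddle point inequality in the limit.\<close>

lemma payoff_finite_saddle:
  fixes X :: "'a::{real_inner, complete_space} set"
  assumes X: "seq_weakly_closed X" "seq_weakly_lsc_on X \<phi>" "\<And>x. x \<in> X \<Longrightarrow> m \<le> \<phi> x" "X \<noteq> {}"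
    and P: "convex P" "P \<subseteq> ball u r"
    and uniq: "\<forall>p\<in>P. \<forall>x\<in>X. \<forall>y\<in>X. (\<forall>z\<in>X. payoff u \<phi> x p \<le> payoff u \<phi> z p) \<longrightarrow>
        (\<forall>z\<in>X. payoff u \<phi> y p \<le> payoff u \<phi> z p) \<longrightarrow> x = y"
    and F: "finite F" "F \<noteq> {}" "F \<subseteq> P"
  obtains x q where "x \<in> X" "q \<in> P" "\<forall>z\<in>X. payoff u \<phi> x q \<le> payoff u \<phi> z q"
    "\<forall>p\<in>F. payoff u \<phi> x p \<le> payoff u \<phi> x q"
proof -
  obtain \<xi> where \<xi>: "\<And>p. \<xi> p \<in> X" "\<And>p z. z \<in> X \<Longrightarrow> payoff u \<phi> (\<xi> p) p \<le> payoff u \<phi> z p"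
    using payoff_minimizer_exists[OF X, of u] by metis
  define J where "J p = payoff u \<phi> (\<xi> p) p" for p
  obtain x0 where x0: "x0 \<in> X" using X(4) by blast
  \<comment> \<open>The fixed competitor \<open>x0\<close> bounds the minimal payoff on
    \<open>P\<close> by \<open>c0\<close>; coercivity then puts the minimisers within
    \<open>R\<close> of \<open>u\<close>.\<close>
  define c0 where "c0 = payoff u \<phi> x0 u + 2 * norm (x0 - u) * r"
  define R where "R = r + sqrt (c0 - m + r\<^sup>2)"
  have Pr: "norm (p - u) \<le> r" if "p \<in> P" for p
    using P(2) that by (auto simp: dist_norm norm_minus_commute)
  have R: "norm (\<xi> p - u) \<le> R" if "p \<in> P" for p
    unfolding R_def
  proof (rule norm_le_of_payoff_le)
    show "norm (p - u) \<le> r" using Pr[OF that] .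
    show "m \<le> \<phi> (\<xi> p)" using X(3)[OF \<xi>(1)] .
    have "payoff u \<phi> x0 p \<le> payoff u \<phi> x0 u + 2 * norm (x0 - u) * norm (u - p)"
      by (rule payoff_le_add) simp
    also have "\<dots> \<le> c0"
      unfolding c0_def using Pr[OF that] by (simp add: mult_left_mono norm_minus_commute)
    finally show "payoff u \<phi> (\<xi> p) p \<le> c0" using \<xi>(2)[OF x0, of p] by simp
  qed
  have hull: "convex hull F \<subseteq> P" using F P by (simp add: hull_minimal)
  obtain p0 where p0: "p0 \<in> F" using F by blast
  have R0: "R \<ge> 0" using R[of p0] p0 F by (meson norm_ge_zero order_trans subsetD)
  \<comment> \<open>\<open>\<xi> q\<close> is a competitor at \<open>p\<close>, and its payoff is
    Lipschitz in the centre with constant \<open>2 * R\<close>.\<close>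
  have Jle: "J p \<le> J q + 2 * R * norm (q - p)" if "q \<in> P" for p q
    using \<xi>(2)[OF \<xi>(1)[of q], of p] payoff_le_add[OF R[OF that]] unfolding J_def
    by (meson order_trans)
  have "continuous_on (convex hull F) J"
  proof (rule continuous_on_subset[OF _ hull], rule lipschitz_on_continuous_on)
    show "(2 * R)-lipschitz_on P J"
    proof (rule lipschitz_onI)
      fix p q assume "p \<in> P" "q \<in> P"
      then show "dist (J p) (J q) \<le> 2 * R * dist p q"
        using Jle[of q p] Jle[of p q] by (simp add: dist_norm norm_minus_commute abs_le_iff)
    qed (simp add: R0)
  qed
  then obtain q where q: "q \<in> convex hull F" "\<And>p. p \<in> convex hull F \<Longrightarrow> J p \<le> J q"
    using continuous_attains_sup[of "convex hull F" J] finite_imp_compact_convex_hull[OF F(1)] F(2)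
    by auto
  have qP: "q \<in> P" using q hull by blast
  have "payoff u \<phi> (\<xi> q) p \<le> J q" if p: "p \<in> F" for p
  proof -
    define t where "t n = 1 / real (Suc n)" for n
    have t: "0 < t n" "t n \<le> 1" for n by (auto simp: t_def)
    have tlim: "t \<longlonglongrightarrow> 0" unfolding t_def by (rule LIMSEQ_Suc[OF lim_1_over_n])
    define p' where "p' n = q + t n *\<^sub>R (p - q)" for n
    have p': "p' n \<in> convex hull F" for n
    proof -
      have "p' n = (1 - t n) *\<^sub>R q + t n *\<^sub>R p" by (simp add: p'_def algebra_simps)
      then show ?thesis
        using convexD_alt[OF convex_convex_hull q(1) hull_inc[OF p]] t[of n] by simp
    qed
    define x where "x n = \<xi> (p' n)" for n
    have xX: "x n \<in> X" for n by (simp add: x_def \<xi>)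
    have xR: "norm (x n - u) \<le> R" for n unfolding x_def using R p' hull by blast
    have Jp': "payoff u \<phi> (x n) (p' n) \<le> J q" for n
      using q(2)[OF p'] by (simp add: x_def J_def)
    \<comment> \<open>The payoff at \<open>p' n\<close> is a convex combination of those at
      \<open>q\<close> and \<open>p\<close>. It is at most \<open>J q\<close> and the one at
      \<open>q\<close> is at least \<open>J q\<close>; dividing by \<open>t n > 0\<close> bounds the
      one at \<open>p\<close>.\<close>
    have atp: "payoff u \<phi> (x n) p \<le> J q" for n
    proof -
      have "(1 - t n) * J q \<le> (1 - t n) * payoff u \<phi> (x n) q"
        using \<xi>(2)[OF xX] t[of n] by (intro mult_left_mono) (auto simp: J_def)
      moreover have "(1 - t n) * payoff u \<phi> (x n) q + t n * payoff u \<phi> (x n) p \<le> J q"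
        using Jp'[of n] by (simp add: p'_def payoff_affine)
      ultimately have "t n * payoff u \<phi> (x n) p \<le> t n * J q" by (simp add: algebra_simps)
      then show ?thesis using t[of n] by simp
    qed
    have atq: "payoff u \<phi> (x n) q \<le> J q + 2 * R * (t n * norm (p - q))" for n
    proof -
      have "norm (p' n - q) = t n * norm (p - q)" using t[of n] by (simp add: p'_def)
      then show ?thesis using payoff_le_add[OF xR, of \<phi> n q "p' n"] Jp'[of n] by simp
    qed
    have "bounded (range x)"
      by (rule bounded_subset[OF bounded_cball[of u R]])
        (use xR in \<open>auto simp: dist_norm norm_minus_commute\<close>)
    then obtain k l where k: "strict_mono (k::nat\<Rightarrow>nat)" and l: "weakly_converges (x \<circ> k) l"
      by (rule bounded_weakly_convergent_subseq)
    have kX: "(x \<circ> k) n \<in> X" for n using xX by simp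
    have "(\<lambda>n. J q + 2 * R * (t (k n) * norm (p - q))) \<longlonglongrightarrow> J q + 2 * R * (0 * norm (p - q))"
      by (intro tendsto_intros LIMSEQ_subseq_LIMSEQ[OF tlim k, unfolded comp_def])
    then have lim: "(\<lambda>n. J q + 2 * R * (t (k n) * norm (p - q))) \<longlonglongrightarrow> J q" by simp
    have lX: "l \<in> X" and lq: "payoff u \<phi> l q \<le> J q"
      using payoff_weak_limit[OF X(1,2) kX l _ lim, of u q] atq by auto
    have lp: "payoff u \<phi> l p \<le> J q"
      using payoff_weak_limit(2)[OF X(1,2) kX l _ tendsto_const] atp by auto
    have "\<forall>z\<in>X. payoff u \<phi> l q \<le> payoff u \<phi> z q"
      using order_trans[OF lq] \<xi>(2) by (simp add: J_def)
    \<comment> \<open>Uniqueness identifies the limit with \<open>\<xi> q\<close>, so one point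
      serves every \<open>p\<close> in \<open>F\<close>.\<close>
    then have "l = \<xi> q" using uniq qP lX \<xi> by simp
    with lp show ?thesis by simp
  qed
  then show thesis using that[of "\<xi> q" q] \<xi> qP by (simp add: J_def)
qed

text \<open>The sublevel sets \<open>?C p\<close> are bounded and weakly closed, and a saddle point
  for finitely many \<open>p\<close> lies in each of theirs; the finite intersection property does
  the rest.\<close>

lemma payoff_minimax:
  fixes X :: "'a::{real_inner, complete_space} set"
  assumes X: "seq_weakly_closed X" "seq_weakly_lsc_on X \<phi>" "\<And>x. x \<in> X \<Longrightarrow> m \<le> \<phi> x" "X \<noteq> {}"
    and P: "convex P" "P \<subseteq> ball u r" "P \<noteq> {}"
    and uniq: "\<forall>p\<in>P. \<forall>x\<in>X. \<forall>y\<in>X. (\<forall>z\<in>X. payoff u \<phi> x p \<le> payoff u \<phi> z p) \<longrightarrow>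
        (\<forall>z\<in>X. payoff u \<phi> y p \<le> payoff u \<phi> z p) \<longrightarrow> x = y"
    and c: "\<forall>p\<in>P. \<forall>x\<in>X. (\<forall>z\<in>X. payoff u \<phi> x p \<le> payoff u \<phi> z p) \<longrightarrow> payoff u \<phi> x p \<le> c"
  shows "\<exists>x\<in>X. \<forall>p\<in>P. payoff u \<phi> x p \<le> c"
proof -
  let ?C = "\<lambda>p. {x \<in> X. payoff u \<phi> x p \<le> c}"
  obtain p0 where p0: "p0 \<in> P" using P(3) by blast
  have "?C p0 \<inter> (\<Inter>p\<in>P. ?C p) \<noteq> {}"
  proof (rule seq_weakly_closed_fip)
    fix F assume F: "finite F" "F \<subseteq> P"
    \<comment> \<open>Inserting \<open>p0\<close> keeps the finite set nonempty and puts
      \<open>x\<close> into the bounded set \<open>?C p0\<close>.\<close>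
    obtain x q where x: "x \<in> X" "q \<in> P" "\<forall>z\<in>X. payoff u \<phi> x q \<le> payoff u \<phi> z q"
      "\<forall>p\<in>insert p0 F. payoff u \<phi> x p \<le> payoff u \<phi> x q"
      using payoff_finite_saddle[OF X P(1,2) uniq, where F = "insert p0 F"] F p0 by auto
    have "payoff u \<phi> x q \<le> c" using c x by blast
    then have "x \<in> ?C p0 \<inter> (\<Inter>p\<in>F. ?C p)" using x by fastforce
    then show "?C p0 \<inter> (\<Inter>p\<in>F. ?C p) \<noteq> {}" by blast
  qed (use X in \<open>auto intro: bounded_payoff_sublevel seq_weakly_closed_payoff_sublevel\<close>)
  then show ?thesis using p0 by blast
qed

section \<open>The bounds on the payoff from \<open>rho\<close> and from density\<close>

text \<open>Compare \<open>x\<close> with almost nearest points \<open>z\<close> of \<open>X\<close>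
  to \<open>p\<close>: up to a vanishing error their payoff is at most \<open>M\<close> plus a term
  of the supremum \<open>rho\<close>, the one for \<open>y = p - u\<close>.\<close>

lemma payoff_le_rho:
  fixes X :: "'a::real_inner set"
  assumes "X \<noteq> {}" and M: "\<And>z. z \<in> X \<Longrightarrow> \<phi> z \<le> M" and p: "norm (p - u) < r"
    and min: "\<forall>z\<in>X. payoff u \<phi> x p \<le> payoff u \<phi> z p"
  shows "payoff u \<phi> x p \<le> rho X u r + M"
proof -
  let ?g = "\<lambda>y. (infdist (u + y) X)\<^sup>2 - (norm y)\<^sup>2"
  have "bdd_above (?g ` {y. norm y < r})"
  proof (rule bdd_aboveI2)
    fix y :: 'a assume "y \<in> {y. norm y < r}"
    then have "infdist (u + y) X \<le> infdist u X + r"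
      using infdist_triangle[of "u + y" X u] by (simp add: dist_norm)
    then show "?g y \<le> (infdist u X + r)\<^sup>2"
      using power_mono[of "infdist (u + y) X" "infdist u X + r" 2]
      by (simp add: infdist_nonneg) (smt (verit) zero_le_power2)
  qed
  then have rho: "?g (p - u) \<le> rho X u r"
    unfolding rho_def using p by (intro cSUP_upper) auto
  have "payoff u \<phi> x p - M + (norm (p - u))\<^sup>2 \<le> (infdist p X)\<^sup>2"
  proof (rule LIMSEQ_le_const)
    have "(\<lambda>n. (infdist p X + 1 / real (Suc n))\<^sup>2) \<longlonglongrightarrow> (infdist p X + 0)\<^sup>2"
      by (intro tendsto_intros LIMSEQ_Suc[OF lim_1_over_n])
    then show "(\<lambda>n. (infdist p X + 1 / real (Suc n))\<^sup>2) \<longlonglongrightarrow> (infdist p X)\<^sup>2" by simp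
    have "payoff u \<phi> x p - M + (norm (p - u))\<^sup>2 \<le> (infdist p X + 1 / real (Suc n))\<^sup>2" for n
    proof -
      obtain z where z: "z \<in> X" "dist p z < infdist p X + 1 / real (Suc n)"
        using infdist_near_point[OF \<open>X \<noteq> {}\<close>, of "1 / real (Suc n)" p] by auto
      then have "(norm (z - p))\<^sup>2 \<le> (infdist p X + 1 / real (Suc n))\<^sup>2"
        by (intro power_mono) (auto simp: dist_norm norm_minus_commute)
      moreover have "payoff u \<phi> x p \<le> payoff u \<phi> z p" using min z by blast
      ultimately show ?thesis using M[OF z(1)] by (simp add: payoff_eq[of u \<phi> z])
    qed
    then show "\<exists>N. \<forall>n\<ge>N. payoff u \<phi> x p - M + (norm (p - u))\<^sup>2 \<le> (infdist p X + 1 / real (Suc n))\<^sup>2"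
      by blast
  qed
  with rho show ?thesis by simp
qed

text \<open>By continuity in \<open>p\<close> the bound extends to the closed ball, where the
  largest payoff occurs, for \<open>x \<noteq> u\<close>, on the sphere in the direction opposite to
  \<open>x - u\<close>.\<close>

lemma payoff_dense_bound:
  fixes S :: "'a::real_inner set"
  assumes S: "closure S = UNIV" and r: "r > 0"
    and le: "\<And>p. p \<in> S \<inter> ball u r \<Longrightarrow> payoff u \<phi> x p \<le> c"
  shows "(norm (x - u))\<^sup>2 + 2 * r * norm (x - u) + \<phi> x \<le> c"
proof -
  have "closure (ball u r \<inter> S) = closure (ball u r)"
    by (rule closure_open_Int_superset) (auto simp: S)
  then have cl: "closure (S \<inter> ball u r) = cball u r" using r by (simp add: Int_commute)
  have "closed {p. payoff u \<phi> x p \<le> c}"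
    unfolding payoff_def by (intro closed_Collect_le continuous_intros)
  then have sub: "cball u r \<subseteq> {p. payoff u \<phi> x p \<le> c}"
    unfolding cl[symmetric] using le by (intro closure_minimal) auto
  \<comment> \<open>Minimises \<open>inner (x - u) (p - u)\<close> over the closed ball. If
    \<open>x = u\<close>, then \<open>sgn\<close> gives \<open>0\<close> and \<open>p = u\<close>,
    which suffices because the inner product vanishes.\<close>
  define p where "p = u - r *\<^sub>R sgn (x - u)"
  have "p \<in> cball u r" using r by (simp add: p_def dist_norm norm_sgn)
  with sub have "payoff u \<phi> x p \<le> c" by blast
  moreover have "inner (x - u) (p - u) = - r * norm (x - u)"
    by (cases "x = u")
      (auto simp: p_def sgn_div_norm dot_square_norm power2_eq_square simp flip: power2_norm_eq_inner)
  ultimately show ?thesis by (simp add: payoff_def)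
qed

section \<open>Contradiction between the two bounds\<close>

theorem theorem1p1:
  fixes X S :: "'a::{real_inner, complete_space} set"
    and u\<^sub>0 :: 'a
    and \<phi> :: "'a \<Rightarrow> real"
    and \<delta> r :: real
  assumes "\<not> convex X"
    and "seq_weakly_closed X"
    and "u\<^sub>0 \<in> convex hull X - X"
    and "\<delta> = infdist u\<^sub>0 X"
    and "convex S"
    and "closure S = UNIV"
    and "bounded (\<phi> ` X)"
    and "seq_weakly_lsc_on X \<phi>"
    and "r > 0"
    and "r > (rho X u\<^sub>0 r - \<delta>\<^sup>2 + (SUP x\<in>X. \<phi> x) - (INF x\<in>X. \<phi> x)) / (2 * \<delta>)"
  shows "\<exists>y\<^sub>0\<in>S. norm (y\<^sub>0 - u\<^sub>0) < r \<and>
           (\<exists>x\<^sub>1 x\<^sub>2. x\<^sub>1 \<noteq> x\<^sub>2 \<and>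
              is_arg_min (\<lambda>x. (norm (x - y\<^sub>0))\<^sup>2 + \<phi> x) (\<lambda>x. x \<in> X) x\<^sub>1 \<and>
              is_arg_min (\<lambda>x. (norm (x - y\<^sub>0))\<^sup>2 + \<phi> x) (\<lambda>x. x \<in> X) x\<^sub>2)"
proof (rule ccontr)
  assume no: "\<not> ?thesis"
  have ne: "X \<noteq> {}" using assms(3) by auto
  \<comment> \<open>\<open>X\<close> is norm closed and \<open>u\<^sub>0\<close> lies outside it.
    Positivity allows the condition on \<open>r\<close> to be multiplied by
    \<open>2 * \<delta>\<close>.\<close>
  have "\<delta> > 0"
    using infdist_pos_not_in_closed[OF seq_weakly_closed_imp_closed] assms ne by blast
  have inf: "(INF x\<in>X. \<phi> x) \<le> \<phi> x" and sup: "\<phi> x \<le> (SUP x\<in>X. \<phi> x)" if "x \<in> X" for x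
    using that assms(7) by (auto intro: cINF_lower cSUP_upper bounded_imp_bdd_below bounded_imp_bdd_above)
  let ?P = "S \<inter> ball u\<^sub>0 r"
  have P: "norm (p - u\<^sub>0) < r" if "p \<in> ?P" for p
    using that by (auto simp: dist_norm norm_minus_commute)
  have "ball u\<^sub>0 r \<inter> S \<noteq> {}"
    using open_Int_closure_eq_empty[of "ball u\<^sub>0 r" S] assms(6,9) by simp
  then have Pne: "?P \<noteq> {}" by blast
  have cP: "convex ?P" using assms(5) by (intro convex_Int convex_ball)
  have "\<exists>x\<in>X. \<forall>p\<in>?P. payoff u\<^sub>0 \<phi> x p \<le> rho X u\<^sub>0 r + (SUP x\<in>X. \<phi> x)"
  proof (rule payoff_minimax[OF assms(2,8) inf ne cP _ Pne])
    show "\<forall>p\<in>?P. \<forall>x\<in>X. \<forall>y\<in>X. (\<forall>z\<in>X. payoff u\<^sub>0 \<phi> x p \<le> payoff u\<^sub>0 \<phi> z p) \<longrightarrow>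
        (\<forall>z\<in>X. payoff u\<^sub>0 \<phi> y p \<le> payoff u\<^sub>0 \<phi> z p) \<longrightarrow> x = y"
    proof (intro ballI impI)
      fix p x y
      assume "p \<in> ?P" "x \<in> X" "y \<in> X" "\<forall>z\<in>X. payoff u\<^sub>0 \<phi> x p \<le> payoff u\<^sub>0 \<phi> z p"
        "\<forall>z\<in>X. payoff u\<^sub>0 \<phi> y p \<le> payoff u\<^sub>0 \<phi> z p"
      then have "is_arg_min (\<lambda>x. (norm (x - p))\<^sup>2 + \<phi> x) (\<lambda>x. x \<in> X) x"
        "is_arg_min (\<lambda>x. (norm (x - p))\<^sup>2 + \<phi> x) (\<lambda>x. x \<in> X) y"
        by (auto simp: is_arg_min_linorder payoff_eq)
      with no P[OF \<open>p \<in> ?P\<close>] \<open>p \<in> ?P\<close> show "x = y" by blast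
    qed
  qed (auto intro: payoff_le_rho[OF ne sup P])
  then obtain x where x: "x \<in> X" "\<And>p. p \<in> ?P \<Longrightarrow> payoff u\<^sub>0 \<phi> x p \<le> rho X u\<^sub>0 r + (SUP x\<in>X. \<phi> x)"
    by blast
  have "(norm (x - u\<^sub>0))\<^sup>2 + 2 * r * norm (x - u\<^sub>0) + \<phi> x \<le> rho X u\<^sub>0 r + (SUP x\<in>X. \<phi> x)"
    using payoff_dense_bound[OF assms(6,9) x(2)] .
  moreover have \<delta>x: "\<delta> \<le> norm (x - u\<^sub>0)"
    using infdist_le[OF x(1), of u\<^sub>0] assms(4) by (simp add: dist_norm norm_minus_commute)
  moreover have "\<delta>\<^sup>2 \<le> (norm (x - u\<^sub>0))\<^sup>2" "2 * r * \<delta> \<le> 2 * r * norm (x - u\<^sub>0)"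
    using \<delta>x \<open>\<delta> > 0\<close> assms(9) by (auto intro: power_mono)
  moreover have "rho X u\<^sub>0 r - \<delta>\<^sup>2 + (SUP x\<in>X. \<phi> x) - (INF x\<in>X. \<phi> x) < 2 * r * \<delta>"
    using assms(10) \<open>\<delta> > 0\<close> by (simp add: field_simps)
  ultimately show False using inf[OF x(1)] by linarith
qed

end
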